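(* Let $n\ge 1$ be an integer and let $\theta$ be a real number different from $0$ and $1$. The transmission probability $T_n(\theta,k)$ has the following properties: (i) $T_n(\theta,k)$ is a $\pi$-periodic function of $k\in\mathbb{R}$; (ii) $T_n(\theta,k)=T_n(\theta,\pi-k)$ for all $k\in(0,\pi)$, i.e., the graph of $T_n(\theta,\cdot)$ on the interval $(0,\pi)$ is symmetric with respect to the line $k=\frac{\pi}{2}$; (iii) $T_n(\theta,k)$ is invariant under the transformations $\theta\mapsto-\theta$ and $\theta\mapsto\theta^{-1}$, i.e., $$T_n(\theta,k)=T_n(-\theta,k)=T_n(\theta^{-1},k)\quad\text{for all }k\in\mathbb{R}.$$
   Context: For an integer $n\ge1$, $\theta\in\mathbb{R}\setminus\{0\}$ and $k\in\mathbb{R}$, consider the scattering problem $$\psi''+k^2\psi=0\ \text{ on }\mathbb{R}\setminus\{0,1,\dots,n-1\},\qquad \psi(j+0)=\theta\psi(j-0),\quad \psi'(j+0)=\theta^{-1}\psi'(j-0),\quad j=0,\dots,n-1,$$ with left scattering solution $\psi_-(x)=e^{ikx}+r_n(\theta,k)e^{-ikx}$ for $x<0$ and $\psi_-(x)=t_n(\theta,k)e^{ikx}$ for $x>n-1$. The reflection amplitude $r_n$ and transmission amplitude $t_n$ are determined (for all $k\in\mathbb{R}$) by $$\begin{bmatrix} t_n(\theta,k)\\0\end{bmatrix}=M_n(\theta,k)\begin{bmatrix}1\\ r_n(\theta,k)\end{bmatrix},\qquad M_n(\theta,k)=M(\theta,(n-1)k)\cdots M(\theta,2k)\,M(\theta,k)\,M(\theta,0),$$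 where $$M(\theta,z)=\frac1{2\theta}\begin{bmatrix}\theta^2+1&(\theta^2-1)e^{-2iz}\\(\theta^2-1)e^{2iz}&\theta^2+1\end{bmatrix}.$$ The transmission probability is $T_n(\theta,k)=|t_n(\theta,k)|^2$. *)

theory Defs
  imports "HOL-Analysis.Analysis"
begin

definition transfer_matrix :: "real \<Rightarrow> real \<Rightarrow> complex^2^2" where
  "transfer_matrix \<theta> z = (1 / (2 * \<theta>)) *\<^sub>R
     vector [vector [of_real (\<theta>\<^sup>2 + 1), of_real (\<theta>\<^sup>2 - 1) * exp (- 2 * \<i> * of_real z)],
             vector [of_real (\<theta>\<^sup>2 - 1) * exp (2 * \<i> * of_real z), of_real (\<theta>\<^sup>2 + 1)]]"

text \<open>The product \<open>M(\<theta>,(n-1)k) \<cdots> M(\<theta>,k) M(\<theta>,0)\<close>; the value at \<open>n = 0\<close> is the empty product.\<close>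

fun total_transfer_matrix :: "nat \<Rightarrow> real \<Rightarrow> real \<Rightarrow> complex^2^2" where
  "total_transfer_matrix 0 \<theta> k = mat 1"
| "total_transfer_matrix (Suc n) \<theta> k =
     transfer_matrix \<theta> (real n * k) ** total_transfer_matrix n \<theta> k"

definition scattering_amplitudes :: "nat \<Rightarrow> real \<Rightarrow> real \<Rightarrow> complex \<Rightarrow> complex \<Rightarrow> bool" where
  "scattering_amplitudes n \<theta> k t r \<longleftrightarrow>
     vector [t, 0] = total_transfer_matrix n \<theta> k *v vector [1, r]"

text \<open>For \<open>\<theta> \<noteq> 0\<close> the pair \<open>(t, r)\<close> exists and is unique,
  see \<open>scattering_amplitudes_unique\<close> below.\<close>

definition transmission_amplitude :: "nat \<Rightarrow> real \<Rightarrow> real \<Rightarrow> complex" where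
  "transmission_amplitude n \<theta> k = (THE t. \<exists>r. scattering_amplitudes n \<theta> k t r)"

definition transmission_probability :: "nat \<Rightarrow> real \<Rightarrow> real \<Rightarrow> real" where
  "transmission_probability n \<theta> k = (cmod (transmission_amplitude n \<theta> k))\<^sup>2"

lemma transfer_matrix_entries:
  "transfer_matrix \<theta> z $ 1 $ 1 = of_real ((\<theta>\<^sup>2 + 1) / (2 * \<theta>))"
  "transfer_matrix \<theta> z $ 1 $ 2 = of_real ((\<theta>\<^sup>2 - 1) / (2 * \<theta>)) * cis (- 2 * z)"
  "transfer_matrix \<theta> z $ 2 $ 1 = of_real ((\<theta>\<^sup>2 - 1) / (2 * \<theta>)) * cis (2 * z)"
  "transfer_matrix \<theta> z $ 2 $ 2 = of_real ((\<theta>\<^sup>2 + 1) / (2 * \<theta>))"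
  unfolding transfer_matrix_def vector_scaleR_component
  by (simp_all add: cis_conv_exp scaleR_conv_of_real mult_ac)

text \<open>All products of transfer matrices lie in \<open>SU(1,1)\<close>.\<close>

lemma total_transfer_matrix_SU11:
  assumes "\<theta> \<noteq> 0"
  shows "total_transfer_matrix n \<theta> k $ 2 $ 2 = cnj (total_transfer_matrix n \<theta> k $ 1 $ 1) \<and>
         total_transfer_matrix n \<theta> k $ 2 $ 1 = cnj (total_transfer_matrix n \<theta> k $ 1 $ 2) \<and>
         det (total_transfer_matrix n \<theta> k) = 1"
proof (induction n)
  case 0
  show ?case by (simp add: mat_def det_2)
next
  case (Suc n)
  define p q where "p = (\<theta>\<^sup>2 + 1) / (2 * \<theta>)" and "q = (\<theta>\<^sup>2 - 1) / (2 * \<theta>)"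
  have "p * p - q * q = 1"
    using assms by (simp add: p_def q_def field_simps power2_eq_square)
  then have pq: "complex_of_real p * of_real p - of_real q * of_real q = 1"
    by (metis of_real_1 of_real_diff of_real_mult)
  have "det (transfer_matrix \<theta> z) = 1" for z
  proof -
    have "(of_real q * cis (- 2 * z)) * (of_real q * cis (2 * z)) =
        of_real q * of_real q * (cis (- 2 * z) * cis (2 * z))"
      by (simp only: mult_ac)
    also have "\<dots> = of_real q * of_real q"
      by (simp add: cis_mult)
    finally show ?thesis
      using pq unfolding det_2 transfer_matrix_entries p_def[symmetric] q_def[symmetric]
      by (simp only:)
  qed
  then have "det (total_transfer_matrix (Suc n) \<theta> k) = 1"
    using Suc by (simp add: det_mul)
  with Suc show ?case
    by (simp add: matrix_matrix_mult_def sum_2 transfer_matrix_entries cis_cnj del: of_real_divide)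
qed

lemma scattering_amplitudes_unique:
  assumes "\<theta> \<noteq> 0"
  shows "\<exists>!(t, r). scattering_amplitudes n \<theta> k t r"
proof -
  define A where "A = total_transfer_matrix n \<theta> k"
  have "A $ 2 $ 2 \<noteq> 0"
  proof
    assume "A $ 2 $ 2 = 0"
    moreover have "A $ 2 $ 2 = cnj (A $ 1 $ 1)" "A $ 2 $ 1 = cnj (A $ 1 $ 2)" "det A = 1"
      using total_transfer_matrix_SU11[OF assms, of n k] by (auto simp: A_def)
    ultimately have "- of_real ((cmod (A $ 1 $ 2))\<^sup>2) = (1 :: complex)"
      by (simp add: det_2 complex_norm_square del: of_real_power)
    then have "- ((cmod (A $ 1 $ 2))\<^sup>2) = 1"
      by (metis of_real_eq_1_iff of_real_minus)
    then show False
      by (smt (verit) zero_le_power2)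
  qed
  have "scattering_amplitudes n \<theta> k t r \<longleftrightarrow>
      t = A $ 1 $ 1 + A $ 1 $ 2 * r \<and> 0 = A $ 2 $ 1 + A $ 2 $ 2 * r" for t r
    by (simp add: scattering_amplitudes_def A_def[symmetric] vec_eq_iff forall_2
        matrix_vector_mult_def sum_2)
  moreover have "0 = A $ 2 $ 1 + A $ 2 $ 2 * r \<longleftrightarrow> r = - A $ 2 $ 1 / A $ 2 $ 2" for r
    using \<open>A $ 2 $ 2 \<noteq> 0\<close> by (auto simp: field_simps eq_neg_iff_add_eq_0)
  ultimately show ?thesis
    by auto
qed

end

theory Submission
  imports Defs
begin

text \<open>Eliminating \<open>r\<^sub>n\<close> and using \<open>det M\<^sub>n = 1\<close> gives \<open>t\<^sub>n = 1 / (M\<^sub>n)\<^sub>2\<^sub>2\<close>, so \<open>T\<^sub>n\<close> depends only on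
  the modulus of the lower right entry of \<open>M\<^sub>n\<close>. Replacing \<open>k\<close> by \<open>k + \<pi>\<close> does not change \<open>M\<^sub>n\<close>,
  \<open>k \<mapsto> -k\<close> conjugates every entry, \<open>\<theta> \<mapsto> -\<theta>\<close> multiplies \<open>M\<^sub>n\<close> by \<open>(-1)\<^sup>n\<close>, and \<open>\<theta> \<mapsto> \<theta>\<^sup>-\<^sup>1\<close> conjugates
  \<open>M\<^sub>n\<close> by the diagonal matrix with entries \<open>1, -1\<close>.\<close>

lemma transmission_amplitude_eq:
  assumes "\<theta> \<noteq> 0"
  shows "transmission_amplitude n \<theta> k = inverse (total_transfer_matrix n \<theta> k $ 2 $ 2)"
proof -
  define A where "A = total_transfer_matrix n \<theta> k"
  have amplitude: "t = inverse (A $ 2 $ 2)" if "scattering_amplitudes n \<theta> k t r" for t r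
  proof -
    have t: "t = A $ 1 $ 1 + A $ 1 $ 2 * r" and r: "A $ 2 $ 2 * r = - A $ 2 $ 1"
      using that by (auto simp: scattering_amplitudes_def A_def[symmetric] vec_eq_iff forall_2
          matrix_vector_mult_def sum_2 eq_neg_iff_add_eq_0 add.commute)
    \<comment> \<open>Multiplying by \<open>A $ 2 $ 2\<close> avoids dividing by it: the result 1
      shows at once that it is invertible and that \<open>t\<close> is its inverse.\<close>
    have "A $ 2 $ 2 * t = A $ 1 $ 1 * A $ 2 $ 2 + A $ 1 $ 2 * (A $ 2 $ 2 * r)"
      by (simp add: t algebra_simps)
    also have "\<dots> = det A"
      by (simp add: r det_2)
    also have "\<dots> = 1"
      using total_transfer_matrix_SU11[OF assms] by (simp add: A_def)
    finally show ?thesis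
      by (metis inverse_unique)
  qed
  obtain t r where "scattering_amplitudes n \<theta> k t r"
    using scattering_amplitudes_unique[OF assms, of n k] by auto
  then show ?thesis
    unfolding transmission_amplitude_def A_def[symmetric]
    by (intro the_equality) (use amplitude in blast)+
qed

lemma transmission_probability_eq:
  assumes "\<theta> \<noteq> 0"
  shows "transmission_probability n \<theta> k = inverse ((cmod (total_transfer_matrix n \<theta> k $ 2 $ 2))\<^sup>2)"
  by (simp add: transmission_probability_def transmission_amplitude_eq[OF assms]
      norm_inverse power_inverse)

lemma cis_add_of_nat_pi: "cis (x + 2 * (real n * pi)) = cis x"
  by (metis cis_mult cis_multiple_2pi Ints_of_nat mult.assoc mult.commute mult_1_right)

text \<open>Multiples of \<open>pi\<close> are allowed because shifting \<open>k\<close> by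
  \<open>pi\<close> shifts the argument \<open>real n * k\<close> of a factor by
  \<open>real n * pi\<close>.\<close>

lemma transfer_matrix_periodic: "transfer_matrix \<theta> (z + real n * pi) = transfer_matrix \<theta> z"
proof -
  have "cis (2 * (z + real n * pi)) = cis (2 * z)"
    using cis_add_of_nat_pi[of "2 * z" n] by (simp add: distrib_left)
  moreover from this have "cis (- 2 * (z + real n * pi)) = cis (- 2 * z)"
    by (metis cis_cnj mult_minus_left)
  ultimately show ?thesis
    by (simp only: vec_eq_iff forall_2 transfer_matrix_entries simp_thms)
qed

lemma total_transfer_matrix_periodic:
  "total_transfer_matrix n \<theta> (k + pi) = total_transfer_matrix n \<theta> k"
  by (induction n) (simp_all add: distrib_left transfer_matrix_periodic)

lemma total_transfer_matrix_uminus_wavenumber: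
  "total_transfer_matrix n \<theta> (- k) $ i $ j = cnj (total_transfer_matrix n \<theta> k $ i $ j)"
proof (induction n arbitrary: i j)
  case 0
  show ?case by (simp add: mat_def)
next
  case (Suc n)
  \<comment> \<open>The coefficients are real and \<open>z\<close> enters only through the phases
    \<open>cis (2 * z)\<close> and \<open>cis (- 2 * z)\<close>.\<close>
  have "transfer_matrix \<theta> (- z) $ a $ b = cnj (transfer_matrix \<theta> z $ a $ b)" for z a b
    using exhaust_2[of a] exhaust_2[of b]
    by (auto simp: transfer_matrix_entries cis_cnj simp del: of_real_divide)
  with Suc show ?case
    by (simp add: matrix_matrix_mult_def)
qed

lemma total_transfer_matrix_uminus:
  "total_transfer_matrix n (- \<theta>) k $ i $ j = (- 1) ^ n * total_transfer_matrix n \<theta> k $ i $ j"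
proof (induction n arbitrary: i j)
  case 0
  show ?case by simp
next
  case (Suc n)
  \<comment> \<open>The prefactor is odd in \<theta>, the remaining matrix even.\<close>
  have "transfer_matrix (- \<theta>) z $ a $ b = - transfer_matrix \<theta> z $ a $ b" for z a b
    by (simp add: transfer_matrix_def)
  with Suc show ?case
    by (simp add: matrix_matrix_mult_def sum_distrib_left sum_negf mult_ac)
qed

lemma total_transfer_matrix_inverse:
  assumes "\<theta> \<noteq> 0"
  shows "total_transfer_matrix n (inverse \<theta>) k $ i $ j =
    (if i = j then 1 else - 1) * total_transfer_matrix n \<theta> k $ i $ j"
proof (induction n arbitrary: i j)
  case 0
  show ?case by (simp add: mat_def)
next
  case (Suc n)
  \<comment> \<open>These are (\<theta> + 1/\<theta>)/2, symmetric under inversion, and (\<theta> -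
    1/\<theta>)/2, antisymmetric, so only the off-diagonal entries change sign.\<close>
  have p: "((inverse \<theta>)\<^sup>2 + 1) / (2 * inverse \<theta>) = (\<theta>\<^sup>2 + 1) / (2 * \<theta>)"
    and q: "((inverse \<theta>)\<^sup>2 - 1) / (2 * inverse \<theta>) = - ((\<theta>\<^sup>2 - 1) / (2 * \<theta>))"
    using assms by (simp_all add: field_simps power2_eq_square)
  have "transfer_matrix (inverse \<theta>) z $ a $ b =
      (if a = b then 1 else - 1) * transfer_matrix \<theta> z $ a $ b" for z a b
    using exhaust_2[of a] exhaust_2[of b]
    by (auto simp: transfer_matrix_entries p q simp del: of_real_divide)
  with Suc show ?case
    using exhaust_2[of i] exhaust_2[of j]
    by (auto simp: matrix_matrix_mult_def sum_2)
qed

theorem theorem1: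
  fixes n :: nat and \<theta> :: real
  assumes "n \<ge> 1" and "\<theta> \<noteq> 0" and "\<theta> \<noteq> 1"
  shows "(\<forall>k. transmission_probability n \<theta> (k + pi) = transmission_probability n \<theta> k) \<and>
         (\<forall>k\<in>{0<..<pi}. transmission_probability n \<theta> k = transmission_probability n \<theta> (pi - k)) \<and>
         (\<forall>k. transmission_probability n \<theta> k = transmission_probability n (- \<theta>) k \<and>
              transmission_probability n \<theta> k = transmission_probability n (inverse \<theta>) k)"
proof -
  have "transmission_probability n \<theta> (k + pi) = transmission_probability n \<theta> k" for k
    by (simp add: transmission_probability_eq assms total_transfer_matrix_periodic)
  moreover have "transmission_probability n \<theta> (pi - k) = transmission_probability n \<theta> k" for k
    \<comment> \<open>Periodicity reduces \<open>pi - k\<close> to \<open>- k\<close>, where the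
      entries are the conjugates of those at \<open>k\<close> and so have the same moduli.\<close>
    using total_transfer_matrix_periodic[of n \<theta> "- k"]
    by (simp add: transmission_probability_eq assms total_transfer_matrix_uminus_wavenumber)
  moreover have "transmission_probability n (- \<theta>) k = transmission_probability n \<theta> k" for k
    by (simp add: transmission_probability_eq assms total_transfer_matrix_uminus
        norm_mult norm_power)
  moreover have "transmission_probability n (inverse \<theta>) k = transmission_probability n \<theta> k" for k
    by (simp add: transmission_probability_eq assms total_transfer_matrix_inverse)
  ultimately show ?thesis
    by simp
qed

end
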